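(* Let $\ell, v, \hat v, y$ be $\{0,1\}$-valued random variables on a common probability space. For $l\in\{0,1\}$ define $p_l, r_l$ by $\Pr[v=1\mid \hat v=1,\ell=l]=1-p_l$ and $\Pr[\hat v=1\mid v=1,\ell=l]=1-r_l$. Let $\gamma_{B2},\varepsilon_{B2}\in[0,1]$ and $g>0$ be such that for all $b,c\in\{0,1\}$ $$\Big|\Pr[y=1\mid v=b,\hat v=c,\ell=1]-\Pr[y=1\mid v=b,\hat v=c,\ell=0]-g\Big|\le\varepsilon_{B2},$$ and such that $|r_0-r_1|\le\gamma_{B2}$ and $|p_0-p_1|\le\gamma_{B2}$. Then $$|G-\hat G|\le 2\gamma_{B2}+3\varepsilon_{B2}.$$
   Context: $\ell$ is a sensitive attribute, $v$ a covariate, $\hat v$ a proxy for $v$, and $y$ a predicted outcome. The true and estimated conditional statistical parity gaps are $$G=\Pr[y=1\mid v=1,\ell=1]-\Pr[y=1\mid v=1,\ell=0],$$ $$\hat G=\Pr[y=1\mid \hat v=1,\ell=1]-\Pr[y=1\mid \hat v=1,\ell=0].$$ Every conditional probability that appears is assumed to be well defined, i.e. its conditioning event has positive probability. *)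

theory Defs
  imports "HOL-Probability.Probability"
begin

text \<open>
  The conditional statistical parity gap of the outcome \<open>y\<close>, with the covariate \<open>w\<close> conditioned on
  \<open>w = 1\<close>. The true gap $G$ is \<open>csp_gap M y v l\<close>; the estimated gap $\hat G$ is \<open>csp_gap M y vh l\<close>,
  where \<open>vh\<close> is the proxy $\hat v$.
\<close>
definition csp_gap :: "'a measure \<Rightarrow> ('a \<Rightarrow> nat) \<Rightarrow> ('a \<Rightarrow> nat) \<Rightarrow> ('a \<Rightarrow> nat) \<Rightarrow> real" where
  "csp_gap M y w l =
     \<P>(\<omega> in M. y \<omega> = 1 \<bar> w \<omega> = 1 \<and> l \<omega> = 1) - \<P>(\<omega> in M. y \<omega> = 1 \<bar> w \<omega> = 1 \<and> l \<omega> = 0)"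

end

theory Submission
  imports Defs
begin

text \<open>
  Each gap lies within \<open>\<gamma> + \<epsilon>\<close> of \<open>g\<close>. By the law of total probability,
  \<open>\<P>(y = 1 \<bar> v = 1, l = a) = (1 - r a) q\<^sub>a + r a q'\<^sub>a\<close>, where \<open>q\<^sub>a\<close> and \<open>q'\<^sub>a\<close> are the
  probabilities conditioned also on \<open>vh = 1\<close> and \<open>vh = 0\<close>. Since \<open>q\<^sub>1 - q\<^sub>0\<close> and \<open>q'\<^sub>1 - q'\<^sub>0\<close> are
  \<open>\<epsilon>\<close>-close to \<open>g\<close>, replacing them by \<open>g\<close> costs a convex combination of errors at most \<open>\<epsilon>\<close>, and what
  remains is \<open>(r 0 - r 1) (q\<^sub>0 - q'\<^sub>0)\<close>, at most \<open>\<gamma>\<close>. The same holds with \<open>v\<close> and \<open>vh\<close> exchanged and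
  \<open>p\<close> for \<open>r\<close>. This yields \<open>2 \<gamma> + 2 \<epsilon>\<close>, slightly better than the claim.
\<close>

lemma mixture_diff_near:
  fixes q0 q1 q0' q1' s0 s1 :: real
  assumes "q0 \<in> {0..1}" "q0' \<in> {0..1}" "s1 \<in> {0..1}"
    and "\<bar>q1 - q0 - g\<bar> \<le> \<epsilon>" "\<bar>q1' - q0' - g\<bar> \<le> \<epsilon>" "\<bar>s0 - s1\<bar> \<le> \<gamma>"
  shows "\<bar>((1 - s1) * q1 + s1 * q1') - ((1 - s0) * q0 + s0 * q0') - g\<bar> \<le> \<gamma> + \<epsilon>"
proof -
  have "((1 - s1) * q1 + s1 * q1') - ((1 - s0) * q0 + s0 * q0') - g
      = (s0 - s1) * (q0 - q0') + ((1 - s1) * (q1 - q0 - g) + s1 * (q1' - q0' - g))"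
    by (simp add: algebra_simps)
  moreover have "\<bar>(s0 - s1) * (q0 - q0')\<bar> \<le> \<gamma> * 1"
    unfolding abs_mult using assms by (intro mult_mono) auto
  moreover have "\<bar>(1 - s1) * (q1 - q0 - g) + s1 * (q1' - q0' - g)\<bar> \<le> \<epsilon>"
    using assms convex_bound_le[of "\<bar>q1 - q0 - g\<bar>" \<epsilon> "\<bar>q1' - q0' - g\<bar>" "1 - s1" s1]
    by (intro order.trans[OF abs_triangle_ineq]) (simp add: abs_mult)
  ultimately show ?thesis by linarith
qed

context prob_space
begin

text \<open>Holds without measurability: monotonicity needs only the larger event to be measurable,
  and a non-measurable event has measure 0, so the quotient is 0.\<close>

lemma cond_prob_bounds: "cond_prob M P Q \<in> {0..1}"
proof (cases "{\<omega> \<in> space M. Q \<omega>} \<in> sets M")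
  case True
  then have "\<P>(\<omega> in M. P \<omega> \<and> Q \<omega>) \<le> \<P>(\<omega> in M. Q \<omega>)"
    by (intro finite_measure_mono) auto
  then show ?thesis
    by (simp add: cond_prob_def divide_le_eq_1 zero_less_measure_iff)
next
  case False
  then show ?thesis by (simp add: cond_prob_def measure_notin_sets)
qed

text \<open>If a conditioning event is null, the identity survives because division by \<open>0\<close> gives \<open>0\<close>.\<close>

lemma cond_prob_total:
  assumes [measurable]: "Measurable.pred M A" "Measurable.pred M B" "Measurable.pred M C"
  shows "cond_prob M A C
    = cond_prob M B C * cond_prob M A (\<lambda>\<omega>. B \<omega> \<and> C \<omega>)
      + (1 - cond_prob M B C) * cond_prob M A (\<lambda>\<omega>. \<not> B \<omega> \<and> C \<omega>)"
proof -
  have split: "\<P>(\<omega> in M. P \<omega>) = \<P>(\<omega> in M. P \<omega> \<and> B \<omega>) + \<P>(\<omega> in M. P \<omega> \<and> \<not> B \<omega>)"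
    if [measurable]: "Measurable.pred M P" for P
    by (subst finite_measure_Union[symmetric]) (auto intro!: arg_cong[where f = prob])
  have mult: "\<P>(\<omega> in M. Q \<omega>) * cond_prob M A Q = \<P>(\<omega> in M. A \<omega> \<and> Q \<omega>)"
    if [measurable]: "Measurable.pred M Q" for Q
  proof -
    have "\<P>(\<omega> in M. A \<omega> \<and> Q \<omega>) \<le> \<P>(\<omega> in M. Q \<omega>)"
      by (intro finite_measure_mono) auto
    then show ?thesis
      by (cases "\<P>(\<omega> in M. Q \<omega>) = 0") (auto simp: cond_prob_def measure_le_0_iff)
  qed
  show ?thesis
  proof (cases "\<P>(\<omega> in M. C \<omega>) = 0")
    case True
    \<comment> \<open>Here \<open>cond_prob M B C\<close> is 0, so the full weight 1 falls on the
      summand for the negation of \<open>B\<close>; its conditioning event is null too, which makes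
      it 0.\<close>
    have "\<P>(\<omega> in M. \<not> B \<omega> \<and> C \<omega>) \<le> \<P>(\<omega> in M. C \<omega>)"
      by (intro finite_measure_mono) auto
    with True have "\<P>(\<omega> in M. \<not> B \<omega> \<and> C \<omega>) = 0"
      by (simp add: measure_le_0_iff)
    with True show ?thesis by (simp add: cond_prob_def)
  next
    case False
    have "\<P>(\<omega> in M. C \<omega>) = \<P>(\<omega> in M. B \<omega> \<and> C \<omega>) + \<P>(\<omega> in M. \<not> B \<omega> \<and> C \<omega>)"
      using split[of C] by (simp add: conj_commute)
    then have compl: "1 - cond_prob M B C = \<P>(\<omega> in M. \<not> B \<omega> \<and> C \<omega>) / \<P>(\<omega> in M. C \<omega>)"
      using False by (simp add: cond_prob_def field_simps)
    have "\<P>(\<omega> in M. A \<omega> \<and> C \<omega>)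
        = \<P>(\<omega> in M. A \<omega> \<and> B \<omega> \<and> C \<omega>) + \<P>(\<omega> in M. A \<omega> \<and> \<not> B \<omega> \<and> C \<omega>)"
      using split[of "\<lambda>\<omega>. A \<omega> \<and> C \<omega>"] by (simp add: conj_ac)
    also have "\<dots> = \<P>(\<omega> in M. B \<omega> \<and> C \<omega>) * cond_prob M A (\<lambda>\<omega>. B \<omega> \<and> C \<omega>)
        + \<P>(\<omega> in M. \<not> B \<omega> \<and> C \<omega>) * cond_prob M A (\<lambda>\<omega>. \<not> B \<omega> \<and> C \<omega>)"
      by (simp add: mult)
    finally show ?thesis
      unfolding compl by (simp add: cond_prob_def[of M A C] cond_prob_def[of M B C] add_divide_distrib)
  qed
qed

text \<open>\<open>w\<close> is the covariate fixed at 1 and \<open>u\<close> the one averaged out;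
  keeping them abstract lets one argument serve both gaps.\<close>

lemma csp_gap_near:
  fixes l w u y :: "'a \<Rightarrow> nat" and s :: "nat \<Rightarrow> real"
  assumes meas: "l \<in> measurable M (count_space {0, 1})" "w \<in> measurable M (count_space {0, 1})"
      "u \<in> measurable M (count_space {0, 1})" "y \<in> measurable M (count_space {0, 1})"
    and s: "\<And>a. a \<in> {0, 1} \<Longrightarrow> \<P>(\<omega> in M. u \<omega> = 1 \<bar> w \<omega> = 1 \<and> l \<omega> = a) = 1 - s a"
    and near: "\<And>c. c \<in> {0, 1} \<Longrightarrow>
        \<bar>\<P>(\<omega> in M. y \<omega> = 1 \<bar> w \<omega> = 1 \<and> u \<omega> = c \<and> l \<omega> = 1)
          - \<P>(\<omega> in M. y \<omega> = 1 \<bar> w \<omega> = 1 \<and> u \<omega> = c \<and> l \<omega> = 0) - g\<bar> \<le> \<epsilon>"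
    and "\<bar>s 0 - s 1\<bar> \<le> \<gamma>"
  shows "\<bar>csp_gap M y w l - g\<bar> \<le> \<gamma> + \<epsilon>"
proof -
  have [measurable]: "l \<in> measurable M (count_space UNIV)" "w \<in> measurable M (count_space UNIV)"
      "u \<in> measurable M (count_space UNIV)" "y \<in> measurable M (count_space UNIV)"
    using meas[THEN measurable_compose, of "\<lambda>x. x" "count_space UNIV"] by simp_all
  \<comment> \<open>The codomain {0, 1} turns the complementary event of the total probability law
    into \<open>u \<omega> = 0\<close>.\<close>
  have u: "u \<omega> \<noteq> 1 \<longleftrightarrow> u \<omega> = 0" if "\<omega> \<in> space M" for \<omega>
    using measurable_space[OF meas(3) that] by auto
  define q where "q c a = \<P>(\<omega> in M. y \<omega> = 1 \<bar> w \<omega> = 1 \<and> u \<omega> = c \<and> l \<omega> = a)" for c a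
  have "\<P>(\<omega> in M. y \<omega> = 1 \<bar> u \<omega> \<noteq> 1 \<and> w \<omega> = 1 \<and> l \<omega> = a) = q 0 a" for a
    unfolding q_def cond_prob_def using u by (simp add: conj_ac cong: conj_cong)
  then have total: "\<P>(\<omega> in M. y \<omega> = 1 \<bar> w \<omega> = 1 \<and> l \<omega> = a) = (1 - s a) * q 1 a + s a * q 0 a"
    if "a \<in> {0, 1}" for a
    using cond_prob_total[of "\<lambda>\<omega>. y \<omega> = 1" "\<lambda>\<omega>. u \<omega> = 1" "\<lambda>\<omega>. w \<omega> = 1 \<and> l \<omega> = a"] s[OF that]
    by (simp add: q_def conj_left_commute)
  have "s 1 \<in> {0..1}"
    using s[of 1] cond_prob_bounds[of "\<lambda>\<omega>. u \<omega> = 1" "\<lambda>\<omega>. w \<omega> = 1 \<and> l \<omega> = 1"] by simp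
  then show ?thesis
    unfolding csp_gap_def using assms(7) near[folded q_def] cond_prob_bounds
    by (simp only: total insert_iff simp_thms, intro mixture_diff_near) (auto simp: q_def)
qed

end

theorem theorem6p4:
  fixes M :: "'a measure"
    and l v vh y :: "'a \<Rightarrow> nat"
    and p r :: "nat \<Rightarrow> real"
    and \<gamma> \<epsilon> g :: real
  assumes "prob_space M"
    and "l \<in> measurable M (count_space {0, 1})"
    and "v \<in> measurable M (count_space {0, 1})"
    and "vh \<in> measurable M (count_space {0, 1})"
    and "y \<in> measurable M (count_space {0, 1})"
    (* the smaller conditioning events; the events {v = 1, l = a} and {vh = 1, l = a} contain them *)
    and pos: "\<forall>a\<in>{0, 1}. \<forall>b\<in>{0, 1}. \<forall>c\<in>{0, 1}.
           \<P>(\<omega> in M. v \<omega> = b \<and> vh \<omega> = c \<and> l \<omega> = a) > 0"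
    and p: "\<forall>a\<in>{0, 1}. \<P>(\<omega> in M. v \<omega> = 1 \<bar> vh \<omega> = 1 \<and> l \<omega> = a) = 1 - p a"
    and r: "\<forall>a\<in>{0, 1}. \<P>(\<omega> in M. vh \<omega> = 1 \<bar> v \<omega> = 1 \<and> l \<omega> = a) = 1 - r a"
    and "\<gamma> \<in> {0..1}" and "\<epsilon> \<in> {0..1}" and "g > 0"
    and "\<forall>b\<in>{0, 1}. \<forall>c\<in>{0, 1}.
           \<bar>\<P>(\<omega> in M. y \<omega> = 1 \<bar> v \<omega> = b \<and> vh \<omega> = c \<and> l \<omega> = 1)
             - \<P>(\<omega> in M. y \<omega> = 1 \<bar> v \<omega> = b \<and> vh \<omega> = c \<and> l \<omega> = 0) - g\<bar> \<le> \<epsilon>"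
    and "\<bar>r 0 - r 1\<bar> \<le> \<gamma>" and "\<bar>p 0 - p 1\<bar> \<le> \<gamma>"
  shows "\<bar>csp_gap M y v l - csp_gap M y vh l\<bar> \<le> 2 * \<gamma> + 3 * \<epsilon>"
proof -
  interpret prob_space M by fact
  have "\<bar>csp_gap M y v l - g\<bar> \<le> \<gamma> + \<epsilon>"
    using assms by (intro csp_gap_near[where u = vh and s = r]) auto
  \<comment> \<open>The roles are swapped: the cell bounds enter with \<open>c = 1\<close> and
    \<open>b\<close> varying, after reordering the conjunction.\<close>
  moreover have "\<bar>csp_gap M y vh l - g\<bar> \<le> \<gamma> + \<epsilon>"
    using assms by (intro csp_gap_near[where u = v and s = p]) (auto simp: conj_left_commute)
  \<comment> \<open>The triangle inequality through \<open>g\<close>, then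
    \<open>\<epsilon> \<ge> 0\<close>.\<close>
  ultimately show ?thesis
    using \<open>\<epsilon> \<in> {0..1}\<close> by auto
qed

end
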